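(* (i) If the edge weight exponent satisfies $0<\alpha<2(\sqrt2-1)$, then $$\frac{1}{n^{1-\frac{\alpha}{2}}}\left(TSP_n-\mathbb{E}TSP_n\right)\longrightarrow 0\quad\text{a.s.}$$ as $n\to\infty$. (ii) Suppose the edge weight function $h$ is a metric and the edge weight exponent satisfies $0<\alpha<1$. Then $$\frac{1}{n^{1-\frac{\alpha}{2}}}\left(TSP_n-\mathbb{E}TSP_n\right)\longrightarrow 0\quad\text{a.s.}$$ as $n\to\infty$.
   Context: Let $S=[-\frac12,\frac12]^2$ be the unit square and $f$ a probability density on $S$ with $\epsilon_1\le \inf_{S} f\le \sup_{S} f\le \epsilon_2$ for constants $0<\epsilon_1\le\epsilon_2<\infty$. Let $X_1,X_2,\ldots$ be i.i.d. with density $f$, all defined on one probability space. Let $d$ be Euclidean distance and $h:S\times S\to[0,\infty)$ a deterministic measurable function with $c_1 d(x,y)\le h(x,y)=h(y,x)\le c_2 d(x,y)$ for all $x,y\in S$, where $c_1,c_2>0$ are constants (in general $h$ need not be a metric). Let $K_n$ be the complete graph on the nodes $X_1,\ldots,X_n$; the edge $e=(X_i,X_j)$ has weight $h^\alpha(e)=h(X_i,X_j)^\alpha$. The weight of a cycle $\mathcal{C}$ is $W(\mathcal{C})=\sum_{e\in\mathcal{C}}h^\alpha(e)$, and $TSP_n$ is the minimum of $W(\mathcal{C})$ over all spanning (Hamiltonian) cycles $\mathcal{C}$ of $K_n$. *)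

theory Defs
  imports "HOL-Probability.Probability"
begin

definition unit_square :: "(real ^ 2) set" where
  "unit_square = cbox (\<chi> i. - 1/2) (\<chi> i. 1/2)"

text \<open>A cycle with vertices \<open>v\<^sub>1, \<dots>, v\<^sub>t\<close> (\<open>t \<ge> 3\<close>) is given by listing its vertices in cyclic order.
  Each edge is recorded once, as an ordered pair following that order; for a symmetric weight
  the choice of direction and of starting vertex is immaterial.\<close>

definition is_cycle :: "'v set \<Rightarrow> 'v list \<Rightarrow> bool" where
  "is_cycle V vs \<longleftrightarrow> distinct vs \<and> 3 \<le> length vs \<and> set vs \<subseteq> V"

definition spanning_cycle :: "'v set \<Rightarrow> 'v list \<Rightarrow> bool" where
  "spanning_cycle V vs \<longleftrightarrow> is_cycle V vs \<and> set vs = V"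

definition cycle_edges :: "'v list \<Rightarrow> ('v \<times> 'v) set" where
  "cycle_edges vs = set (zip vs (rotate1 vs))"

definition cycle_weight ::
    "('p \<Rightarrow> 'p \<Rightarrow> real) \<Rightarrow> real \<Rightarrow> (nat \<Rightarrow> 'p) \<Rightarrow> nat list \<Rightarrow> real" where
  "cycle_weight h \<alpha> x vs = (\<Sum>(i, j)\<in>cycle_edges vs. h (x i) (x j) powr \<alpha>)"

text \<open>The node \<open>x i\<close> is identified with its index \<open>i \<in> {1..n}\<close>. For \<open>n < 3\<close> there is no spanning
  cycle and the value is unspecified.\<close>

definition TSP :: "('p \<Rightarrow> 'p \<Rightarrow> real) \<Rightarrow> real \<Rightarrow> (nat \<Rightarrow> 'p) \<Rightarrow> nat \<Rightarrow> real" where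
  "TSP h \<alpha> x n = Min {cycle_weight h \<alpha> x vs | vs. spanning_cycle {1..n} vs}"

text \<open>The locale \<^locale>\<open>Metric_space\<close> constrains the distance function also outside the carrier
  (nonnegativity and symmetry), where \<open>h\<close> is meant to be arbitrary; hence the truncation.\<close>

definition metric_on :: "'p set \<Rightarrow> ('p \<Rightarrow> 'p \<Rightarrow> real) \<Rightarrow> bool" where
  "metric_on S h \<longleftrightarrow> Metric_space S (\<lambda>x y. if x \<in> S \<and> y \<in> S then h x y else 0)"

end

theory Submission
  imports Defs
begin

text \<open>
  Moving a single node of a tour affects at most two of its edges. On the square all edge weights
  \<open>h\<^sup>\<alpha>\<close> are bounded by some constant \<open>D\<close>, so the weight of each fixed tour, and with it the minimum
  over all tours, changes by at most \<open>2D\<close> when one of the \<open>n\<close> nodes is moved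
  (\<open>TSP_bounded_differences\<close>). The nodes being independent, McDiarmid's inequality
  (\<open>McDiarmid_inequality\<close>) shows that \<open>TSP\<^sub>n\<close> deviates from its expectation by \<open>t\<close> or more with
  probability at most \<open>2 exp (- t\<^sup>2 / (2 D\<^sup>2 n))\<close>.

  For \<open>t = \<epsilon> n\<^bsup>1 - \<alpha>/2\<^esup>\<close> this bound is \<open>2 exp (- K n\<^bsup>1 - \<alpha>\<^esup>)\<close> with \<open>K = \<epsilon>\<^sup>2 / (2 D\<^sup>2)\<close>, which is summable
  in \<open>n\<close> as soon as \<open>\<alpha> < 1\<close>. The Borel-Cantelli lemma, applied along a sequence of \<open>\<epsilon>\<close> tending
  to \<open>0\<close>, gives the almost sure convergence. Both parts of the theorem are instances, since
  \<open>2 (sqrt 2 - 1) < 1\<close>.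

  McDiarmid's inequality is obtained by exponential moments: integrating out one coordinate at a
  time, Hoeffding's lemma for that coordinate contributes a factor \<open>exp (l\<^sup>2 c\<^sub>i\<^sup>2 / 8)\<close>, and the
  partially integrated function still has bounded differences in the remaining coordinates.
\<close>

section \<open>McDiarmid's inequality\<close>

definition bounded_differences ::
    "'i set \<Rightarrow> ('i \<Rightarrow> 'b set) \<Rightarrow> ('i \<Rightarrow> real) \<Rightarrow> (('i \<Rightarrow> 'b) \<Rightarrow> real) \<Rightarrow> bool" where
  "bounded_differences I S c g \<longleftrightarrow>
     (\<forall>x\<in>PiE I S. \<forall>i\<in>I. \<forall>y\<in>S i. \<bar>g (x(i := y)) - g x\<bar> \<le> c i)"

lemma bounded_differencesD:
  assumes "bounded_differences I S c g" "x \<in> PiE I S" "i \<in> I" "y \<in> S i"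
  shows "\<bar>g (x(i := y)) - g x\<bar> \<le> c i"
  using assms by (auto simp: bounded_differences_def)

lemma bounded_differences_uminus:
  "bounded_differences I S c g \<Longrightarrow> bounded_differences I S c (\<lambda>x. - g x)"
  by (auto simp: bounded_differences_def abs_minus_commute)

text \<open>
  Any point of the product is reached from any other by changing one coordinate after the other.
  In particular a function with bounded differences is bounded, hence integrable
  as soon as it is measurable.
\<close>

lemma bounded_differences_oscillation:
  assumes bd: "bounded_differences I S c g" and "finite I"
    and x: "x \<in> PiE I S" and y: "y \<in> PiE I S"
  shows "\<bar>g y - g x\<bar> \<le> sum c I"
proof -
  have "\<bar>g (override_on x y A) - g x\<bar> \<le> sum c A" if "finite A" "A \<subseteq> I" for A
    using that
  proof (induction A)
    case (insert i A)
    have mem: "override_on x y A \<in> PiE I S"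
      using x y insert.prems by (auto simp: override_on_def PiE_iff extensional_def)
    have "\<bar>g ((override_on x y A)(i := y i)) - g (override_on x y A)\<bar> \<le> c i"
      using bounded_differencesD[OF bd mem, of i "y i"] insert.prems y by auto
    moreover have "(override_on x y A)(i := y i) = override_on x y (insert i A)"
      by (auto simp: override_on_def)
    ultimately show ?case
      using insert by simp
  qed simp
  from this[OF \<open>finite I\<close>] have "\<bar>g (override_on x y I) - g x\<bar> \<le> sum c I" by simp
  moreover have "override_on x y I = y"
    using x y by (auto simp: override_on_def PiE_iff extensional_def fun_eq_iff)
  ultimately show ?thesis by simp
qed

lemma bounded_differences_integrable:
  assumes N: "\<And>i. prob_space (N i)" and fin: "finite I"
    and g: "g \<in> borel_measurable (PiM I N)"
    and bd: "bounded_differences I (\<lambda>i. space (N i)) c g"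
  shows "integrable (PiM I N) g"
proof -
  interpret P: prob_space "PiM I N" by (rule prob_space_PiM) (rule N)
  obtain x0 where x0: "x0 \<in> space (PiM I N)" using P.not_empty by blast
  show ?thesis
  proof (rule P.integrable_const_bound)
    show "AE x in PiM I N. norm (g x) \<le> \<bar>g x0\<bar> + sum c I"
    proof (rule AE_I2)
      fix x assume "x \<in> space (PiM I N)"
      then have "\<bar>g x - g x0\<bar> \<le> sum c I"
        using bounded_differences_oscillation[OF bd fin] x0 by (simp add: space_PiM)
      then show "norm (g x) \<le> \<bar>g x0\<bar> + sum c I" by simp
    qed
  qed (rule g)
qed

text \<open>
  Hoeffding's lemma for a function of which only the oscillation is controlled: its values lie in
  an interval of length \<open>c\<close> that starts at their infimum.
\<close>

lemma nn_integral_exp_oscillation_le: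
  assumes "prob_space N" and g: "g \<in> borel_measurable N"
    and osc: "\<And>x y. x \<in> space N \<Longrightarrow> y \<in> space N \<Longrightarrow> \<bar>g y - g x\<bar> \<le> c"
    and l: "l > 0"
  shows "(\<integral>\<^sup>+x. ennreal (exp (l * (g x - (\<integral>x. g x \<partial>N)))) \<partial>N) \<le> ennreal (exp (l\<^sup>2 * c\<^sup>2 / 8))"
proof -
  interpret N: prob_space N by fact
  define a where "a = (INF x\<in>space N. g x)"
  obtain x0 where x0: "x0 \<in> space N" using N.not_empty by auto
  have bdd: "bdd_below (g ` space N)"
  proof (rule bdd_belowI2)
    fix x assume "x \<in> space N"
    then show "g x0 - c \<le> g x" using osc[OF x0, of x] by linarith
  qed
  interpret B: interval_bounded_random_variable N g a "a + c"
  proof unfold_locales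
    show "AE x in N. g x \<in> {a..a + c}"
    proof (rule AE_I2)
      fix x assume x: "x \<in> space N"
      have "a \<le> g x" unfolding a_def using bdd x by (rule cINF_lower)
      moreover have "g x - c \<le> a" unfolding a_def
      proof (rule cINF_greatest)
        fix y assume "y \<in> space N"
        then show "g x - c \<le> g y" using osc[OF x, of y] by linarith
      qed (use x in auto)
      ultimately show "g x \<in> {a..a + c}" by simp
    qed
  qed (rule g)
  show ?thesis using B.Hoeffdings_lemma_nn_integral[OF l] by simp
qed

text \<open>
  The induction integrates out the coordinate \<open>i\<close> last added. Write \<open>G x\<close> for the mean of \<open>g\<close> over
  this coordinate and split \<open>g - m = (G x - m) + (g - G x)\<close>. For fixed \<open>x\<close> the second part is
  centred and oscillates by at most \<open>c i\<close>, so Hoeffding's lemma bounds its exponential moment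
  uniformly in \<open>x\<close>; the induction hypothesis applies to \<open>G\<close>, which has the same mean \<open>m\<close> as \<open>g\<close>.
\<close>

lemma nn_integral_exp_bounded_differences_le:
  assumes N: "\<And>i. prob_space (N i)" and "finite I" and l: "l > 0"
    and "g \<in> borel_measurable (PiM I N)"
    and "bounded_differences I (\<lambda>i. space (N i)) c g"
  shows "(\<integral>\<^sup>+x. ennreal (exp (l * (g x - (\<integral>x. g x \<partial>PiM I N)))) \<partial>PiM I N)
           \<le> ennreal (exp (l\<^sup>2 * (\<Sum>i\<in>I. (c i)\<^sup>2) / 8))"
  using assms(2,4,5)
proof (induction I arbitrary: g)
  case empty
  show ?case
    by (simp add: PiM_empty nn_integral_count_space_finite lebesgue_integral_count_space_finite)
next
  case (insert i I)
  note [measurable] = insert.prems(1)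
  interpret PI: prob_space "PiM I N" by (rule prob_space_PiM) (rule N)
  interpret Ni: prob_space "N i" by (rule N)
  interpret P: product_prob_space N I
    by (rule product_prob_spaceI) (rule N)
  note bd = insert.prems(2)
  define G where "G x = (\<integral>y. g (x(i := y)) \<partial>N i)" for x
  have G_meas [measurable]: "G \<in> borel_measurable (PiM I N)"
    unfolding G_def by measurable
  have upd: "x(i := y) \<in> PiE (insert i I) (\<lambda>i. space (N i))"
    if "x \<in> space (PiM I N)" "y \<in> space (N i)" for x y
    using that insert.hyps by (auto simp: space_PiM PiE_iff extensional_def)
  have sec_meas: "(\<lambda>y. g (x(i := y))) \<in> borel_measurable (N i)" if "x \<in> space (PiM I N)" for x
    using that insert.hyps by measurable
  have sec_osc: "\<bar>g (x(i := y')) - g (x(i := y))\<bar> \<le> c i"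
    if "x \<in> space (PiM I N)" "y \<in> space (N i)" "y' \<in> space (N i)" for x y y'
    using bounded_differencesD[OF bd upd[OF that(1,2)], of i y'] that by (simp only: fun_upd_upd insertI1 simp_thms)
  have sec_int: "integrable (N i) (\<lambda>y. g (x(i := y)))" if x: "x \<in> space (PiM I N)" for x
  proof -
    obtain y0 where y0: "y0 \<in> space (N i)" using Ni.not_empty by auto
    show ?thesis
    proof (rule Ni.integrable_const_bound)
      show "AE y in N i. norm (g (x(i := y))) \<le> \<bar>g (x(i := y0))\<bar> + c i"
      proof (rule AE_I2)
        fix y assume "y \<in> space (N i)"
        then show "norm (g (x(i := y))) \<le> \<bar>g (x(i := y0))\<bar> + c i"
          using sec_osc[OF x y0, of y] by simp
      qed
    qed (rule sec_meas[OF x])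
  qed
  have bdG: "bounded_differences I (\<lambda>i. space (N i)) c G"
    unfolding bounded_differences_def
  proof (intro ballI)
    fix x j z assume x: "x \<in> PiE I (\<lambda>i. space (N i))" and j: "j \<in> I" and z: "z \<in> space (N j)"
    have x1: "x \<in> space (PiM I N)" using x by (simp add: space_PiM)
    have x2: "x(j := z) \<in> space (PiM I N)"
      using x j z by (auto simp: space_PiM PiE_iff extensional_def)
    have ji: "j \<noteq> i" using j insert.hyps by auto
    have "\<bar>G (x(j := z)) - G x\<bar> = \<bar>\<integral>y. g (x(j := z, i := y)) - g (x(i := y)) \<partial>N i\<bar>"
      unfolding G_def by (simp add: sec_int[OF x1] sec_int[OF x2])
    also have "\<dots> \<le> (\<integral>y. \<bar>g (x(j := z, i := y)) - g (x(i := y))\<bar> \<partial>N i)"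
      by (rule integral_abs_bound)
    also have "\<dots> \<le> (\<integral>y. c j \<partial>N i)"
    proof (rule integral_mono)
      fix y assume y: "y \<in> space (N i)"
      have "\<bar>g ((x(i := y))(j := z)) - g (x(i := y))\<bar> \<le> c j"
        by (rule bounded_differencesD[OF bd upd[OF x1 y]]) (use j z in auto)
      then show "\<bar>g (x(j := z, i := y)) - g (x(i := y))\<bar> \<le> c j"
        using ji by (simp add: fun_upd_twist)
    qed (use sec_int[OF x1] sec_int[OF x2] in auto)
    finally show "\<bar>G (x(j := z)) - G x\<bar> \<le> c j" by (simp add: Ni.prob_space)
  qed
  have int_g: "integrable (PiM (insert i I) N) g"
    by (rule bounded_differences_integrable[OF N _ _ bd]) (use insert in auto)
  define m where "m = (\<integral>x. g x \<partial>PiM (insert i I) N)"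
  have m: "m = (\<integral>x. G x \<partial>PiM I N)"
    unfolding m_def G_def by (rule P.product_integral_insert[OF insert.hyps int_g])
  let ?e = "ennreal (exp (l\<^sup>2 * (c i)\<^sup>2 / 8))"
  have "(\<integral>\<^sup>+x. ennreal (exp (l * (g x - m))) \<partial>PiM (insert i I) N)
      = (\<integral>\<^sup>+x. (\<integral>\<^sup>+y. ennreal (exp (l * (g (x(i := y)) - m))) \<partial>N i) \<partial>PiM I N)"
    by (rule P.product_nn_integral_insert[OF insert.hyps]) measurable
  also have "\<dots> \<le> (\<integral>\<^sup>+x. ennreal (exp (l * (G x - m))) * ?e \<partial>PiM I N)"
  proof (rule nn_integral_mono)
    fix x assume x: "x \<in> space (PiM I N)"
    note [measurable] = sec_meas[OF x]
    have "(\<integral>\<^sup>+y. ennreal (exp (l * (g (x(i := y)) - m))) \<partial>N i)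
        = (\<integral>\<^sup>+y. ennreal (exp (l * (G x - m))) * ennreal (exp (l * (g (x(i := y)) - G x))) \<partial>N i)"
      by (simp add: ennreal_mult[symmetric] exp_add[symmetric] algebra_simps)
    also have "\<dots> = ennreal (exp (l * (G x - m))) * (\<integral>\<^sup>+y. ennreal (exp (l * (g (x(i := y)) - G x))) \<partial>N i)"
      by (rule nn_integral_cmult) measurable
    also have "\<dots> \<le> ennreal (exp (l * (G x - m))) * ?e"
      unfolding G_def
      by (intro mult_left_mono nn_integral_exp_oscillation_le N sec_meas x sec_osc l) auto
    finally show "(\<integral>\<^sup>+y. ennreal (exp (l * (g (x(i := y)) - m))) \<partial>N i)
        \<le> ennreal (exp (l * (G x - m))) * ?e" .
  qed
  also have "\<dots> = (\<integral>\<^sup>+x. ennreal (exp (l * (G x - m))) \<partial>PiM I N) * ?e"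
    by (rule nn_integral_multc) measurable
  also have "\<dots> \<le> ennreal (exp (l\<^sup>2 * (\<Sum>i\<in>I. (c i)\<^sup>2) / 8)) * ?e"
    unfolding m by (intro mult_right_mono insert.IH G_meas bdG) auto
  also have "\<dots> = ennreal (exp (l\<^sup>2 * (\<Sum>i\<in>insert i I. (c i)\<^sup>2) / 8))"
    using insert.hyps
    by (simp add: ennreal_mult[symmetric] exp_add[symmetric] algebra_simps add_divide_distrib)
  finally show ?case unfolding m_def .
qed


text \<open>
  Chernoff's bound with the exponent that minimises \<open>- l t + l\<^sup>2 V / 8\<close>, where \<open>V\<close> is the sum of the
  squared differences. If \<open>V = 0\<close>, division by zero makes the right-hand side \<open>1\<close>, so the bound is
  trivial in that case.
\<close>

lemma McDiarmid_upper_tail_PiM: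
  assumes N: "\<And>i. prob_space (N i)" and fin: "finite I" and t: "t \<ge> 0"
    and g[measurable]: "g \<in> borel_measurable (PiM I N)"
    and bd: "bounded_differences I (\<lambda>i. space (N i)) c g"
  shows "measure (PiM I N) {x\<in>space (PiM I N). g x - (\<integral>x. g x \<partial>PiM I N) \<ge> t}
           \<le> exp (- 2 * t\<^sup>2 / (\<Sum>i\<in>I. (c i)\<^sup>2))"
proof -
  interpret P: prob_space "PiM I N" by (rule prob_space_PiM) (rule N)
  define m where "m = (\<integral>x. g x \<partial>PiM I N)"
  define V where "V = (\<Sum>i\<in>I. (c i)\<^sup>2)"
  show ?thesis
  proof (cases "t = 0 \<or> V = 0")
    case True
    then have "exp (- 2 * t\<^sup>2 / V) = 1" by auto
    then show ?thesis unfolding V_def[symmetric] using P.prob_le_1 by metis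
  next
    case False
    moreover have "V \<ge> 0" unfolding V_def by (rule sum_nonneg) simp
    ultimately have pos: "t > 0" "V > 0" using t by auto
    define l where "l = 4 * t / V"
    have l: "l > 0" using pos by (simp add: l_def)
    have "emeasure (PiM I N) {x\<in>space (PiM I N). g x - m \<ge> t}
        \<le> ennreal (exp (- l * t)) *
           (\<integral>\<^sup>+x. ennreal (exp (l * (g x - m))) * indicator (space (PiM I N)) x \<partial>PiM I N)"
      by (rule Chernoff_ineq_nn_integral_ge[OF l]) measurable
    also have "(\<integral>\<^sup>+x. ennreal (exp (l * (g x - m))) * indicator (space (PiM I N)) x \<partial>PiM I N)
        = (\<integral>\<^sup>+x. ennreal (exp (l * (g x - m))) \<partial>PiM I N)"
      by (rule nn_integral_cong) simp
    also have "ennreal (exp (- l * t)) * \<dots> \<le> ennreal (exp (- l * t)) * ennreal (exp (l\<^sup>2 * V / 8))"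
      unfolding m_def V_def
      by (intro mult_left_mono nn_integral_exp_bounded_differences_le N fin l g bd) auto
    also have "\<dots> = ennreal (exp (- l * t + l\<^sup>2 * V / 8))"
      by (simp add: ennreal_mult[symmetric] exp_add[symmetric])
    also have "- l * t + l\<^sup>2 * V / 8 = - 2 * t\<^sup>2 / V"
      using pos by (simp add: l_def field_simps power2_eq_square)
    finally show ?thesis
      by (simp add: P.emeasure_eq_measure m_def V_def)
  qed
qed

text \<open>
  Independence means that the joint law of the \<open>X i\<close> is a product measure, which carries the
  one-sided bound over from product spaces; applied to \<open>g\<close> and to \<open>- g\<close> it gives both tails.
\<close>

lemma (in prob_space) McDiarmid_inequality:
  assumes I: "finite I" "I \<noteq> {}" and t: "t \<ge> 0"
    and indep: "indep_vars N X I"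
    and g[measurable]: "g \<in> borel_measurable (PiM I N)"
    and bd: "bounded_differences I (\<lambda>i. space (N i)) c g"
  defines "Z \<equiv> \<lambda>\<omega>. g (\<lambda>i\<in>I. X i \<omega>)"
  shows "random_variable borel Z"
    and "prob {\<omega>\<in>space M. \<bar>Z \<omega> - expectation Z\<bar> \<ge> t} \<le> 2 * exp (- 2 * t\<^sup>2 / (\<Sum>i\<in>I. (c i)\<^sup>2))"
proof -
  have rv: "random_variable (N i) (X i)" if "i \<in> I" for i
    using indep that by (auto simp: indep_vars_def)
  have rvI[measurable]: "(\<lambda>\<omega>. \<lambda>i\<in>I. X i \<omega>) \<in> measurable M (PiM I N)"
    by (rule measurable_restrict) (rule rv)
  show Z[measurable]: "random_variable borel Z"
    unfolding Z_def by measurable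
  \<comment> \<open>The bound on product spaces wants a probability measure at every index, so the laws of
      the \<open>X i\<close> are padded by point masses outside \<open>I\<close>.\<close>
  define Q where "Q i = (if i \<in> I then distr M (N i) (X i) else return (count_space UNIV) undefined)" for i
  have Q: "prob_space (Q i)" for i
    by (auto simp: Q_def intro!: prob_space_distr rv prob_space_return)
  have Q_space: "space (Q i) = space (N i)" if "i \<in> I" for i
    using that by (simp add: Q_def)
  have Q_sets: "sets (PiM I Q) = sets (PiM I N)"
    by (rule sets_PiM_cong) (auto simp: Q_def)
  have law: "distr M (PiM I N) (\<lambda>\<omega>. \<lambda>i\<in>I. X i \<omega>) = PiM I Q"
  proof -
    have "distr M (PiM I N) (\<lambda>\<omega>. \<lambda>i\<in>I. X i \<omega>) = PiM I (\<lambda>i. distr M (N i) (X i))"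
      using indep by (subst (asm) indep_vars_iff_distr_eq_PiM'[OF I(2)]) (auto intro: rv)
    also have "\<dots> = PiM I Q" by (rule PiM_cong) (auto simp: Q_def)
    finally show ?thesis .
  qed
  have bdQ: "bounded_differences I (\<lambda>i. space (Q i)) c g"
    using bd Q_space by (simp add: bounded_differences_def cong: PiE_cong)
  have gQ: "g \<in> borel_measurable (PiM I Q)"
    using g measurable_cong_sets[OF Q_sets refl] by blast
  have upper: "prob {\<omega>\<in>space M. u (\<lambda>i\<in>I. X i \<omega>) - expectation (\<lambda>\<omega>. u (\<lambda>i\<in>I. X i \<omega>)) \<ge> t}
      \<le> exp (- 2 * t\<^sup>2 / (\<Sum>i\<in>I. (c i)\<^sup>2))"
    if u[measurable]: "u \<in> borel_measurable (PiM I N)" and uQ: "u \<in> borel_measurable (PiM I Q)"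
      and bdu: "bounded_differences I (\<lambda>i. space (Q i)) c u" for u
  proof -
    define m where "m = (\<integral>x. u x \<partial>PiM I Q)"
    have m: "expectation (\<lambda>\<omega>. u (\<lambda>i\<in>I. X i \<omega>)) = m"
      unfolding m_def law[symmetric] by (subst integral_distr) auto
    have "measure (PiM I Q) {x\<in>space (PiM I Q). u x - m \<ge> t}
        = measure (distr M (PiM I N) (\<lambda>\<omega>. \<lambda>i\<in>I. X i \<omega>)) {x\<in>space (PiM I N). u x - m \<ge> t}"
      using sets_eq_imp_space_eq[OF Q_sets] by (simp add: law)
    also have "\<dots> = prob ((\<lambda>\<omega>. \<lambda>i\<in>I. X i \<omega>) -` {x\<in>space (PiM I N). u x - m \<ge> t} \<inter> space M)"
      by (rule measure_distr) measurable
    also have "(\<lambda>\<omega>. \<lambda>i\<in>I. X i \<omega>) -` {x\<in>space (PiM I N). u x - m \<ge> t} \<inter> space M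
        = {\<omega>\<in>space M. u (\<lambda>i\<in>I. X i \<omega>) - m \<ge> t}"
      using measurable_space[OF rvI] by auto
    finally show ?thesis
      using McDiarmid_upper_tail_PiM[OF Q I(1) t uQ bdu] unfolding m m_def[symmetric] by simp
  qed
  let ?A = "{\<omega>\<in>space M. Z \<omega> - expectation Z \<ge> t}"
  let ?B = "{\<omega>\<in>space M. - Z \<omega> - expectation (\<lambda>\<omega>. - Z \<omega>) \<ge> t}"
  have "prob {\<omega>\<in>space M. \<bar>Z \<omega> - expectation Z\<bar> \<ge> t} \<le> prob (?A \<union> ?B)"
    by (rule finite_measure_mono) (measurable, auto)
  also have "\<dots> \<le> prob ?A + prob ?B"
    by (rule measure_Un_le) measurable
  also have "prob ?A \<le> exp (- 2 * t\<^sup>2 / (\<Sum>i\<in>I. (c i)\<^sup>2))"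
    unfolding Z_def by (rule upper[OF g gQ bdQ])
  also have "prob ?B \<le> exp (- 2 * t\<^sup>2 / (\<Sum>i\<in>I. (c i)\<^sup>2))"
    unfolding Z_def
    by (rule upper[of "\<lambda>x. - g x"]) (use g gQ bdQ in \<open>auto intro: bounded_differences_uminus\<close>)
  finally show "prob {\<omega>\<in>space M. \<bar>Z \<omega> - expectation Z\<bar> \<ge> t}
      \<le> 2 * exp (- 2 * t\<^sup>2 / (\<Sum>i\<in>I. (c i)\<^sup>2))" by simp
qed

section \<open>Moving one node of a tour\<close>

lemma finite_spanning_cycles: "finite {vs. spanning_cycle {1..n::nat} vs}"
proof (rule finite_subset)
  show "{vs. spanning_cycle {1..n} vs} \<subseteq> {vs. set vs \<subseteq> {1..n} \<and> length vs = n}"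
    by (auto simp: spanning_cycle_def is_cycle_def dest: distinct_card)
  show "finite {vs. set vs \<subseteq> {1..n} \<and> length vs = n}"
    by (rule finite_lists_length_eq) simp
qed

lemma spanning_cycle_exists: "n \<ge> 3 \<Longrightarrow> \<exists>vs. spanning_cycle {1..n::nat} vs"
  by (rule exI[of _ "[1..<Suc n]"]) (auto simp: spanning_cycle_def is_cycle_def)

lemma TSP_altdef:
  "TSP h \<alpha> x n = Min ((\<lambda>vs. cycle_weight h \<alpha> x vs) ` {vs. spanning_cycle {1..n} vs})"
  unfolding TSP_def by (rule arg_cong[of _ _ Min]) auto

lemma cycle_edges_vertices:
  "(i, j) \<in> cycle_edges vs \<Longrightarrow> i \<in> set vs \<and> j \<in> set vs"
  by (auto simp: cycle_edges_def dest: set_zip_leftD set_zip_rightD)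

lemma finite_cycle_edges: "finite (cycle_edges vs)"
  by (simp add: cycle_edges_def)

text \<open>
  Every vertex starts at most one edge of the oriented cycle and ends at most one.
\<close>

lemma card_incident_cycle_edges_le:
  assumes "distinct vs"
  shows "card {e \<in> cycle_edges vs. fst e = k \<or> snd e = k} \<le> 2"
proof -
  let ?z = "zip vs (rotate1 vs)"
  have "distinct (map fst ?z)" "distinct (map snd ?z)"
    using assms by simp_all
  then have "inj_on fst (set ?z)" "inj_on snd (set ?z)"
    by (simp_all only: distinct_map)
  then have "card {e \<in> cycle_edges vs. fst e = k} \<le> 1" "card {e \<in> cycle_edges vs. snd e = k} \<le> 1"
    by (auto simp: cycle_edges_def card_le_Suc0_iff_eq inj_on_def)
  moreover have "{e \<in> cycle_edges vs. fst e = k \<or> snd e = k}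
      = {e \<in> cycle_edges vs. fst e = k} \<union> {e \<in> cycle_edges vs. snd e = k}" by auto
  ultimately show ?thesis
    using card_Un_le[of "{e \<in> cycle_edges vs. fst e = k}" "{e \<in> cycle_edges vs. snd e = k}"] by simp
qed

text \<open>
  Only the edges incident to the moved node change, and before and after the move their total
  weight lies between \<open>0\<close> and \<open>2D\<close>. This is why the bound is \<open>2D\<close> and not \<open>4D\<close>.
\<close>

lemma cycle_weight_move_node:
  assumes D: "\<And>p q. p \<in> S \<Longrightarrow> q \<in> S \<Longrightarrow> h p q powr \<alpha> \<le> D" and D0: "D \<ge> 0"
    and vs: "distinct vs" and x: "\<And>i. i \<in> set vs \<Longrightarrow> x i \<in> S" and y: "y \<in> S"
  shows "\<bar>cycle_weight h \<alpha> (x(k := y)) vs - cycle_weight h \<alpha> x vs\<bar> \<le> 2 * D"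
proof -
  define w where "w u e = h (u (fst e)) (u (snd e)) powr \<alpha>" for u :: "nat \<Rightarrow> 'a" and e
  define F where "F = {e \<in> cycle_edges vs. fst e = k \<or> snd e = k}"
  define R where "R = cycle_edges vs - F"
  have fin: "finite F" "finite R" by (simp_all add: F_def R_def finite_cycle_edges)
  have split: "cycle_weight h \<alpha> u vs = sum (w u) F + sum (w u) R" for u
  proof -
    have "cycle_weight h \<alpha> u vs = sum (w u) (cycle_edges vs)"
      by (simp add: cycle_weight_def w_def case_prod_unfold)
    also have "\<dots> = sum (w u) R + sum (w u) F"
      unfolding R_def by (rule sum.subset_diff) (auto simp: F_def finite_cycle_edges)
    finally show ?thesis by simp
  qed
  have bounds: "0 \<le> sum (w u) F \<and> sum (w u) F \<le> 2 * D" if "\<And>i. i \<in> set vs \<Longrightarrow> u i \<in> S" for u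
  proof
    show "0 \<le> sum (w u) F" by (rule sum_nonneg) (simp add: w_def)
    have "sum (w u) F \<le> of_nat (card F) * D"
      by (rule sum_bounded_above)
         (auto simp: w_def F_def dest!: cycle_edges_vertices intro!: D that)
    also have "\<dots> \<le> 2 * D"
      using card_incident_cycle_edges_le[OF vs, of k] D0 unfolding F_def
      by (intro mult_right_mono) auto
    finally show "sum (w u) F \<le> 2 * D" .
  qed
  have "sum (w (x(k := y))) R = sum (w x) R"
    by (rule sum.cong) (auto simp: R_def F_def w_def)
  moreover have "0 \<le> sum (w (x(k := y))) F \<and> sum (w (x(k := y))) F \<le> 2 * D"
    by (rule bounds) (use x y in auto)
  moreover note bounds[of x, OF x]
  ultimately show ?thesis unfolding split by linarith
qed

lemma abs_Min_image_diff_le: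
  fixes f g :: "'a \<Rightarrow> real"
  assumes "finite A" "A \<noteq> {}" and "\<And>a. a \<in> A \<Longrightarrow> \<bar>f a - g a\<bar> \<le> K"
  shows "\<bar>Min (f ` A) - Min (g ` A)\<bar> \<le> K"
proof -
  have "Min (u ` A) \<le> Min (v ` A) + K" if "\<And>a. a \<in> A \<Longrightarrow> \<bar>u a - v a\<bar> \<le> K" for u v :: "'a \<Rightarrow> real"
  proof -
    have "Min (v ` A) \<in> v ` A" using assms by (intro Min_in) auto
    then obtain a where a: "a \<in> A" "Min (v ` A) = v a" by auto
    have "Min (u ` A) \<le> u a" using assms a by (intro Min_le) auto
    then show ?thesis using that[OF a(1)] a(2) by linarith
  qed
  from this[of f g] this[of g f] show ?thesis
    using assms(3) by (force simp: abs_minus_commute)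
qed

text \<open>
  The bound of \<open>cycle_weight_move_node\<close> is uniform in the tour and therefore passes to the minimum.
  With fewer than three nodes there is no tour, and the value of the minimum is unspecified.
\<close>

lemma TSP_bounded_differences:
  assumes D: "\<And>p q. p \<in> S \<Longrightarrow> q \<in> S \<Longrightarrow> h p q powr \<alpha> \<le> D" and D0: "D \<ge> 0" and n: "n \<ge> 3"
  shows "bounded_differences {1..n} (\<lambda>_. S) (\<lambda>_. 2 * D) (\<lambda>x. TSP h \<alpha> x n)"
  unfolding bounded_differences_def TSP_altdef
proof (intro ballI abs_Min_image_diff_le finite_spanning_cycles)
  show "{vs. spanning_cycle {1..n} vs} \<noteq> {}"
    using spanning_cycle_exists[OF n] by auto
  fix x i y vs
  assume "x \<in> PiE {1..n} (\<lambda>_. S)" "i \<in> {1..n}" "y \<in> S" "vs \<in> {vs. spanning_cycle {1..n} vs}"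
  then show "\<bar>cycle_weight h \<alpha> (x(i := y)) vs - cycle_weight h \<alpha> x vs\<bar> \<le> 2 * D"
    by (intro cycle_weight_move_node D D0) (auto simp: spanning_cycle_def is_cycle_def)
qed

lemma TSP_cong:
  assumes "\<And>i. i \<in> {1..n} \<Longrightarrow> x i = x' i"
  shows "TSP h \<alpha> x n = TSP h \<alpha> x' n"
proof -
  have "cycle_weight h \<alpha> x vs = cycle_weight h \<alpha> x' vs" if "spanning_cycle {1..n} vs" for vs
    unfolding cycle_weight_def
    by (rule sum.cong)
       (use that assms in \<open>auto simp: spanning_cycle_def dest!: cycle_edges_vertices\<close>)
  then show ?thesis unfolding TSP_altdef by (intro arg_cong[of _ _ Min] image_cong) auto
qed

lemma TSP_measurable:
  fixes h :: "'p::second_countable_topology \<Rightarrow> 'p \<Rightarrow> real"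
  assumes h: "(\<lambda>(x, y). h x y) \<in> borel_measurable (restrict_space borel (S \<times> S))"
    and N: "sets N = sets (restrict_space borel S)"
  shows "(\<lambda>x. TSP h \<alpha> x n) \<in> borel_measurable (PiM {1..n} (\<lambda>_. N))"
  unfolding TSP_altdef
proof (rule borel_measurable_Min[OF finite_spanning_cycles])
  fix vs assume "vs \<in> {vs. spanning_cycle {1..n} vs}"
  then have vs: "set vs = {1..n}" by (simp add: spanning_cycle_def)
  let ?P = "PiM {1..n} (\<lambda>_. N)"
  have comp: "(\<lambda>x. x k) \<in> measurable ?P (restrict_space borel S)" if "k \<in> {1..n}" for k
    using measurable_component_singleton[OF that, of "\<lambda>_. N"]
      measurable_cong_sets[OF refl N] by blast
  have "(\<lambda>x. h (x i) (x j)) \<in> borel_measurable ?P" if ij: "i \<in> {1..n}" "j \<in> {1..n}" for i j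
  proof -
    have "(\<lambda>x. (x i, x j)) \<in> measurable ?P (restrict_space borel (S \<times> S))"
      using comp[OF ij(1)] comp[OF ij(2)]
      by (auto simp: measurable_restrict_space2_iff intro!: borel_measurable_Pair)
    from measurable_compose[OF this h] show ?thesis by simp
  qed
  then show "(\<lambda>x. cycle_weight h \<alpha> x vs) \<in> borel_measurable (PiM {1..n} (\<lambda>_. N))"
    unfolding cycle_weight_def case_prod_unfold
    by (intro borel_measurable_sum powr_real_measurable borel_measurable_const)
       (use vs in \<open>auto dest!: cycle_edges_vertices\<close>)
qed

section \<open>Almost sure convergence\<close>

text \<open>
  Powers beat logarithms: eventually \<open>K n\<^sup>b \<ge> 2 ln n\<close>, so the terms are eventually below \<open>1 / n\<^sup>2\<close>.
\<close>

lemma summable_exp_neg_powr: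
  assumes K: "K > 0" and b: "b > 0"
  shows "summable (\<lambda>n. exp (- K * real n powr b))"
proof (rule summable_comparison_test_ev)
  have "((\<lambda>n. ln (real n) / real n powr b) \<longlongrightarrow> 0) sequentially"
    by (rule lim_ln_over_power[OF b])
  then have "eventually (\<lambda>n. ln (real n) / real n powr b < K / 2) sequentially"
    by (rule order_tendstoD) (use K in simp)
  then show "eventually (\<lambda>n. norm (exp (- K * real n powr b)) \<le> 1 / real n ^ 2) sequentially"
    using eventually_gt_at_top[of 0]
  proof eventually_elim
    case (elim n)
    then have "2 * ln (real n) \<le> K * real n powr b" by (simp add: field_simps)
    then have "exp (- K * real n powr b) \<le> exp (- (2 * ln (real n)))" by simp
    also have "\<dots> = 1 / real n ^ 2"
      using elim by (simp add: exp_minus exp_double inverse_eq_divide)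
    finally show ?case by simp
  qed
  show "summable (\<lambda>n. 1 / real n ^ 2)"
    using inverse_power_summable[of 2] by (simp add: inverse_eq_divide)
qed

text \<open>
  The condition \<open>\<alpha> < 1\<close> says that the normalisation
  \<open>n\<^bsup>1 - \<alpha>/2\<^esup>\<close> exceeds the fluctuation scale \<open>n\<^bsup>1/2\<^esup>\<close> by a power of \<open>n\<close>, which makes
  the deviation probabilities summable.
\<close>

lemma (in prob_space) AE_TSP_minus_expectation_tendsto_0:
  fixes X :: "nat \<Rightarrow> 'a \<Rightarrow> 'p::second_countable_topology"
  assumes indep: "indep_vars (\<lambda>_. N) X {1..}"
    and N: "sets N = sets (restrict_space borel S)"
    and h: "(\<lambda>(x, y). h x y) \<in> borel_measurable (restrict_space borel (S \<times> S))"
    and D: "\<And>p q. p \<in> S \<Longrightarrow> q \<in> S \<Longrightarrow> h p q powr \<alpha> \<le> D" and D0: "D > 0"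
    and \<alpha>: "\<alpha> < 1"
  shows "AE \<omega> in M. (\<lambda>n. 1 / real n powr (1 - \<alpha> / 2) *
           (TSP h \<alpha> (\<lambda>i. X i \<omega>) n - (\<integral>\<omega>'. TSP h \<alpha> (\<lambda>i. X i \<omega>') n \<partial>M))) \<longlonglongrightarrow> 0"
proof -
  define Z where "Z n \<omega> = TSP h \<alpha> (\<lambda>i. X i \<omega>) n" for n \<omega>
  have space_N: "space N = S"
    using sets_eq_imp_space_eq[OF N] by (simp add: space_restrict_space)
  have Z_alt: "TSP h \<alpha> (\<lambda>i\<in>{1..n}. X i \<omega>) n = Z n \<omega>" for n \<omega>
    unfolding Z_def by (rule TSP_cong) auto
  have Z_meas: "random_variable borel (Z n)"
    and Z_tail: "prob {\<omega>\<in>space M. \<bar>Z n \<omega> - expectation (Z n)\<bar> \<ge> t} \<le> 2 * exp (- t\<^sup>2 / (2 * D\<^sup>2 * real n))"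
    if n: "n \<ge> 3" and t: "t \<ge> 0" for n t
  proof -
    have I: "finite {1..n}" "{1..n} \<noteq> {}" using n by auto
    have indep_n: "indep_vars (\<lambda>_. N) X {1..n}" by (rule indep_vars_subset[OF indep]) auto
    have bd: "bounded_differences {1..n} (\<lambda>_. space N) (\<lambda>_. 2 * D) (\<lambda>x. TSP h \<alpha> x n)"
      unfolding space_N by (rule TSP_bounded_differences[OF D _ n]) (use D0 in auto)
    note McD = McDiarmid_inequality[OF I t indep_n TSP_measurable[OF h N] bd, unfolded Z_alt]
    show "random_variable borel (Z n)" by (rule McD(1))
    have "- 2 * t\<^sup>2 / (\<Sum>i\<in>{1..n}. (2 * D)\<^sup>2) = - t\<^sup>2 / (2 * D\<^sup>2 * real n)"
      by (simp add: field_simps power2_eq_square)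
    with McD(2) show "prob {\<omega>\<in>space M. \<bar>Z n \<omega> - expectation (Z n)\<bar> \<ge> t}
        \<le> 2 * exp (- t\<^sup>2 / (2 * D\<^sup>2 * real n))" by (simp only:)
  qed
  have ev: "AE \<omega> in M. eventually (\<lambda>n. \<bar>Z n \<omega> - expectation (Z n)\<bar> < \<epsilon> * real n powr (1 - \<alpha> / 2)) sequentially"
    if \<epsilon>: "\<epsilon> > 0" for \<epsilon>
  proof -
    \<comment> \<open>Below three nodes the tour length is unspecified; finitely many events are irrelevant
        for Borel-Cantelli and are made empty.\<close>
    define A where "A n = (if n < 3 then {}
      else {\<omega>\<in>space M. \<bar>Z n \<omega> - expectation (Z n)\<bar> \<ge> \<epsilon> * real n powr (1 - \<alpha> / 2)})" for n
    define K where "K = \<epsilon>\<^sup>2 / (2 * D\<^sup>2)"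
    have K: "K > 0" using \<epsilon> D0 by (simp add: K_def)
    have A_sets: "A n \<in> sets M" for n
    proof (cases "n < 3")
      case False
      then have [measurable]: "random_variable borel (Z n)" by (intro Z_meas[of n 0]) auto
      show ?thesis using False unfolding A_def by simp
    qed (simp add: A_def)
    have A_prob: "prob (A n) \<le> 2 * exp (- K * real n powr (1 - \<alpha>))" for n
    proof (cases "n < 3")
      case False
      then have n: "n \<ge> 3" by simp
      have "(real n powr (1 - \<alpha> / 2))\<^sup>2 = real n powr (1 - \<alpha>) * real n"
        using n powr_add[of "real n" "1 - \<alpha> / 2" "1 - \<alpha> / 2"] powr_add[of "real n" "1 - \<alpha>" 1]
        by (simp add: power2_eq_square)
      then have "- (\<epsilon> * real n powr (1 - \<alpha> / 2))\<^sup>2 / (2 * D\<^sup>2 * real n) = - K * real n powr (1 - \<alpha>)"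
        using n D0 by (simp add: K_def power_mult_distrib)
      moreover have "\<epsilon> * real n powr (1 - \<alpha> / 2) \<ge> 0" using \<epsilon> by simp
      ultimately show ?thesis
        using Z_tail[OF n, of "\<epsilon> * real n powr (1 - \<alpha> / 2)"] n by (simp add: A_def)
    qed (simp add: A_def)
    have "AE \<omega> in M. eventually (\<lambda>n. \<omega> \<in> space M - A n) sequentially"
    proof (rule borel_cantelli_AE1[OF A_sets])
      show "emeasure M (A n) < \<infinity>" for n by (simp add: emeasure_eq_measure)
      show "summable (\<lambda>n. prob (A n))"
        by (rule summable_comparison_test'[OF summable_mult[OF summable_exp_neg_powr[OF K]]])
           (use A_prob \<alpha> in auto)
    qed
    then show ?thesis
    proof eventually_elim
      case (elim \<omega>)
      then show ?case using eventually_ge_at_top[of 3]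
        by eventually_elim (auto simp: A_def not_le)
    qed
  qed
  \<comment> \<open>A countable sequence of tolerances keeps the exceptional set a null set.\<close>
  have "AE \<omega> in M. \<forall>k. eventually (\<lambda>n. \<bar>Z n \<omega> - expectation (Z n)\<bar>
      < 1 / real (Suc k) * real n powr (1 - \<alpha> / 2)) sequentially"
    unfolding AE_all_countable by (intro allI ev) simp
  then show ?thesis
  proof eventually_elim
    case (elim \<omega>)
    have "(\<lambda>n. 1 / real n powr (1 - \<alpha> / 2) * (Z n \<omega> - expectation (Z n))) \<longlonglongrightarrow> 0"
    proof (rule tendstoI)
      fix r :: real assume "r > 0"
      then obtain k where k: "1 / real (Suc k) < r" by (rule nat_approx_posE)
      show "eventually (\<lambda>n. dist (1 / real n powr (1 - \<alpha> / 2) * (Z n \<omega> - expectation (Z n))) 0 < r) sequentially"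
        using elim[rule_format, of k] eventually_gt_at_top[of 0]
      proof eventually_elim
        case (elim n)
        then have p: "real n powr (1 - \<alpha> / 2) > 0" by simp
        have "\<bar>Z n \<omega> - expectation (Z n)\<bar> < r * real n powr (1 - \<alpha> / 2)"
          using elim(1) mult_strict_right_mono[OF k p] by linarith
        then show ?case using p by (simp add: dist_real_def abs_mult field_simps)
      qed
    qed
    then show ?case unfolding Z_def .
  qed
qed

theorem theorem7:
  fixes M :: "'a measure"
    and X :: "nat \<Rightarrow> 'a \<Rightarrow> real ^ 2"
    and f :: "real ^ 2 \<Rightarrow> real"
    and h :: "real ^ 2 \<Rightarrow> real ^ 2 \<Rightarrow> real"
    and \<epsilon>\<^sub>1 \<epsilon>\<^sub>2 c\<^sub>1 c\<^sub>2 \<alpha> :: real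
  assumes "prob_space M"
    and "0 < \<epsilon>\<^sub>1" and "\<epsilon>\<^sub>1 \<le> \<epsilon>\<^sub>2"
    and "\<And>x. x \<in> unit_square \<Longrightarrow> \<epsilon>\<^sub>1 \<le> f x \<and> f x \<le> \<epsilon>\<^sub>2"
    and "\<And>i. 1 \<le> i \<Longrightarrow> distributed M (restrict_space lborel unit_square) (X i) (\<lambda>x. ennreal (f x))"
    and "prob_space.indep_vars M (\<lambda>_. restrict_space lborel unit_square) X {1..}"
    and "0 < c\<^sub>1" and "0 < c\<^sub>2"
    and "(\<lambda>(x, y). h x y) \<in> borel_measurable (restrict_space borel (unit_square \<times> unit_square))"
    and "\<And>x y. x \<in> unit_square \<Longrightarrow> y \<in> unit_square \<Longrightarrow>
           c\<^sub>1 * dist x y \<le> h x y \<and> h x y = h y x \<and> h x y \<le> c\<^sub>2 * dist x y"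
  shows "(0 < \<alpha> \<and> \<alpha> < 2 * (sqrt 2 - 1) \<longrightarrow>
            (AE \<omega> in M.
              (\<lambda>n. 1 / real n powr (1 - \<alpha> / 2) *
                 (TSP h \<alpha> (\<lambda>i. X i \<omega>) n - (\<integral>\<omega>'. TSP h \<alpha> (\<lambda>i. X i \<omega>') n \<partial>M)))
              \<longlonglongrightarrow> 0)) \<and>
         (metric_on unit_square h \<and> 0 < \<alpha> \<and> \<alpha> < 1 \<longrightarrow>
            (AE \<omega> in M.
              (\<lambda>n. 1 / real n powr (1 - \<alpha> / 2) *
                 (TSP h \<alpha> (\<lambda>i. X i \<omega>) n - (\<integral>\<omega>'. TSP h \<alpha> (\<lambda>i. X i \<omega>') n \<partial>M)))
              \<longlonglongrightarrow> 0))"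
proof -
  interpret prob_space M by fact
  let ?N = "restrict_space lborel (unit_square :: (real ^ 2) set)"
  have "bounded (unit_square :: (real ^ 2) set)" by (simp add: unit_square_def)
  then obtain d where d: "0 < d" "\<And>x y :: real ^ 2. x \<in> unit_square \<Longrightarrow> y \<in> unit_square \<Longrightarrow> dist x y \<le> d"
    unfolding bounded_two_points by (metis max.strict_coboundedI1 max.coboundedI2 zero_less_one)
  have main: "AE \<omega> in M. (\<lambda>n. 1 / real n powr (1 - \<alpha> / 2) *
      (TSP h \<alpha> (\<lambda>i. X i \<omega>) n - (\<integral>\<omega>'. TSP h \<alpha> (\<lambda>i. X i \<omega>') n \<partial>M))) \<longlonglongrightarrow> 0"
    if \<alpha>: "0 < \<alpha>" "\<alpha> < 1"
  proof (rule AE_TSP_minus_expectation_tendsto_0[OF assms(6) _ assms(9) _ _ \<alpha>(2)])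
    show "sets ?N = sets (restrict_space borel unit_square)"
      by (rule sets_restrict_space_cong) simp
    show "0 < (c\<^sub>2 * d) powr \<alpha>" using d \<open>0 < c\<^sub>2\<close> by simp
    fix p q :: "real ^ 2" assume pq: "p \<in> unit_square" "q \<in> unit_square"
    have "0 \<le> c\<^sub>1 * dist p q" using \<open>0 < c\<^sub>1\<close> by simp
    also have "\<dots> \<le> h p q" using assms(10)[OF pq] by blast
    finally have "0 \<le> h p q" .
    moreover have "h p q \<le> c\<^sub>2 * d"
      using assms(10)[OF pq] mult_left_mono[OF d(2)[OF pq], of c\<^sub>2] \<open>0 < c\<^sub>2\<close> by linarith
    ultimately show "h p q powr \<alpha> \<le> (c\<^sub>2 * d) powr \<alpha>" using \<alpha> by (intro powr_mono2) auto
  qed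
  have "2 * (sqrt 2 - 1) < (1 :: real)"
    using real_less_lsqrt[of "3 / 2" 2] by (simp add: power2_eq_square)
  then show ?thesis using main by auto
qed

end
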